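(* (Variational equivalence.) For $u,v:\Omega\cup\Omega_I^\omega\to\mathbb R$, $\delta\in(0,\infty)$ and the equivalence kernel $\gamma_{\rm eq}$ defined by $$\begin{aligned}2\gamma_{\rm eq}(\mathbf x,\mathbf y)=\int_{\mathbb R^n}\big[&\boldsymbol\alpha(\mathbf x,\mathbf y)\omega(\mathbf x,\mathbf y)\cdot\boldsymbol\alpha(\mathbf x,\mathbf z)\omega(\mathbf x,\mathbf z)+\boldsymbol\alpha(\mathbf z,\mathbf y)\omega(\mathbf z,\mathbf y)\cdot\boldsymbol\alpha(\mathbf x,\mathbf y)\omega(\mathbf x,\mathbf y)\\&+\boldsymbol\alpha(\mathbf z,\mathbf y)\omega(\mathbf z,\mathbf y)\cdot\boldsymbol\alpha(\mathbf x,\mathbf z)\omega(\mathbf x,\mathbf z)\big]\,d\mathbf z,\end{aligned}$$ the variational forms associated with the truncated weighted and truncated unweighted nonlocal operators are equivalent. That is, $$\mathcal A(u,v)=\int_{\Omega\cup\Omega_I^\omega}\int_{\Omega\cup\Omega_I^\omega}(u(\mathbf y)-u(\mathbf x))(v(\mathbf y)-v(\mathbf x))\,\gamma_{\rm eq}(\mathbf x,\mathbf y)\,d\mathbf y\,d\mathbf x=\int_{\Omega\cup\Omega_I^\omega}\mathcal G_\omega u(\mathbf x)\cdot\mathcal G_\omega v(\mathbf x)\,d\mathbf x=\mathcal A_\omega(u,v)$$ for all $v$ with $v=0$ in $\Omega_I^\omega$, where $\Omega_I^\omega$ is the interaction domain associated with the weighted Laplacian operator $\mathcal L_\omega$.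
   Context: $\Omega\subset\mathbb R^n$ ($n\in\{1,2,3\}$) is an open bounded set. The interaction kernel is $\boldsymbol\alpha(\mathbf x,\mathbf y)=\boldsymbol\rho(\mathbf x,\mathbf y)\mathbf 1(|\mathbf x-\mathbf y|\le\delta)$ with $\boldsymbol\rho:\mathbb R^n\times\mathbb R^n\to\mathbb R^n$ antisymmetric; the weight $\omega:\mathbb R^n\times\mathbb R^n\to\mathbb R$ is nonnegative and symmetric. The interaction domain is $\Omega_I^\omega=\{\mathbf y\in\mathbb R^n\setminus\Omega:|\mathbf x-\mathbf y|\le2\delta\text{ for some }\mathbf x\in\Omega\}$. The weighted gradient and divergence are $$\mathcal G_\omega u(\mathbf x)=\int_{\mathbb R^n}(u(\mathbf y)-u(\mathbf x))\boldsymbol\alpha(\mathbf x,\mathbf y)\omega(\mathbf x,\mathbf y)\,d\mathbf y,\qquad\mathcal D_\omega\mathbf v(\mathbf x)=\int_{\mathbb R^n}(\omega(\mathbf x,\mathbf y)\mathbf v(\mathbf x)+\omega(\mathbf y,\mathbf x)\mathbf v(\mathbf y))\cdot\boldsymbol\alpha(\mathbf x,\mathbf y)\,d\mathbf y,$$ and the weighted Laplacian is $\mathcal L_\omega u(\mathbf x)=\mathcal D_\omega\mathcal G_\omega u(\mathbf x)$ for $\mathbf x\in\Omega$. The unweighted operator is the unweighted Laplacian with kernel $\gamma_{\rm eq}$, $\mathcal Lu(\mathbf x)=2\int_{\mathbb R^n}(u(\mathbf y)-u(\mathbf x))\gamma_{\rm eq}(\mathbf x,\mathbf y)\,d\mathbf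 y$, and $\mathcal A$ is its variational form. Integrals are intended in the principal value sense where needed.
   Formalization: Added: ρ, ω, u, v are Borel measurable; the principal values defining G_ω u, G_ω v and γ_eq exist a.e.; with the kernel cut off at ε both forms converge absolutely as triple integrals, and their integrands are bounded by integrable functions independent of ε. *)

theory Defs
  imports "HOL-Analysis.Analysis"
begin

definition interaction_domain :: "(real^'n) set \<Rightarrow> real \<Rightarrow> (real^'n) set" where
  "interaction_domain \<Omega> \<delta> = {y. y \<notin> \<Omega> \<and> (\<exists>x\<in>\<Omega>. norm (x - y) \<le> 2 * \<delta>)}"

definition truncated_kernel ::
    "(real^'n \<Rightarrow> real^'n \<Rightarrow> real^'n) \<Rightarrow> real \<Rightarrow> real^'n \<Rightarrow> real^'n \<Rightarrow> real^'n" where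
  "truncated_kernel \<rho> \<delta> x y = (if norm (x - y) \<le> \<delta> then \<rho> x y else 0)"

text \<open>Principal values are limits, as \<open>\<epsilon>\<close> tends to 0 from above, of absolutely convergent
  integrals in which the singular kernel is removed at distances at most \<open>\<epsilon>\<close>.
  For the gradient this deletes the ball of radius \<open>\<epsilon>\<close> around \<open>x\<close> from the domain of integration.
  In the equivalence kernel every factor is cut off at its own singularity.\<close>

definition cutoff ::
    "real \<Rightarrow> (real^'n \<Rightarrow> real^'n \<Rightarrow> real^'n) \<Rightarrow> real^'n \<Rightarrow> real^'n \<Rightarrow> real^'n" where
  "cutoff \<epsilon> \<alpha> x y = (if \<epsilon> < norm (x - y) then \<alpha> x y else 0)"

definition has_pv_integral ::
    "(real \<Rightarrow> 'a::euclidean_space \<Rightarrow> 'b::euclidean_space) \<Rightarrow> 'b \<Rightarrow> bool" where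
  "has_pv_integral F I \<longleftrightarrow>
     (\<forall>\<epsilon>>0. integrable lebesgue (F \<epsilon>)) \<and>
     ((\<lambda>\<epsilon>. integral\<^sup>L lebesgue (F \<epsilon>)) \<longlongrightarrow> I) (at_right 0)"

definition pv_integral ::
    "(real \<Rightarrow> 'a::euclidean_space \<Rightarrow> 'b::euclidean_space) \<Rightarrow> 'b" where
  "pv_integral F = (THE I. has_pv_integral F I)"

definition gradient_integrand ::
    "(real^'n \<Rightarrow> real^'n \<Rightarrow> real^'n) \<Rightarrow> (real^'n \<Rightarrow> real^'n \<Rightarrow> real) \<Rightarrow> (real^'n \<Rightarrow> real) \<Rightarrow>
     real^'n \<Rightarrow> real^'n \<Rightarrow> real^'n" where
  "gradient_integrand \<alpha> \<omega> u x y = ((u y - u x) * \<omega> x y) *\<^sub>R \<alpha> x y"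

definition weighted_gradient ::
    "(real^'n \<Rightarrow> real^'n \<Rightarrow> real^'n) \<Rightarrow> (real^'n \<Rightarrow> real^'n \<Rightarrow> real) \<Rightarrow> (real^'n \<Rightarrow> real) \<Rightarrow>
     real^'n \<Rightarrow> real^'n" where
  "weighted_gradient \<alpha> \<omega> u x = pv_integral (\<lambda>\<epsilon>. gradient_integrand (cutoff \<epsilon> \<alpha>) \<omega> u x)"

definition eq_kernel_integrand ::
    "(real^'n \<Rightarrow> real^'n \<Rightarrow> real^'n) \<Rightarrow> (real^'n \<Rightarrow> real^'n \<Rightarrow> real) \<Rightarrow>
     real^'n \<Rightarrow> real^'n \<Rightarrow> real^'n \<Rightarrow> real" where
  "eq_kernel_integrand \<alpha> \<omega> x y z =
     (\<omega> x y *\<^sub>R \<alpha> x y) \<bullet> (\<omega> x z *\<^sub>R \<alpha> x z) +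
     (\<omega> z y *\<^sub>R \<alpha> z y) \<bullet> (\<omega> x y *\<^sub>R \<alpha> x y) +
     (\<omega> z y *\<^sub>R \<alpha> z y) \<bullet> (\<omega> x z *\<^sub>R \<alpha> x z)"

definition equivalence_kernel ::
    "(real^'n \<Rightarrow> real^'n \<Rightarrow> real^'n) \<Rightarrow> (real^'n \<Rightarrow> real^'n \<Rightarrow> real) \<Rightarrow>
     real^'n \<Rightarrow> real^'n \<Rightarrow> real" where
  "equivalence_kernel \<alpha> \<omega> x y =
     pv_integral (\<lambda>\<epsilon>. eq_kernel_integrand (cutoff \<epsilon> \<alpha>) \<omega> x y) / 2"

definition unweighted_form ::
    "(real^'n) set \<Rightarrow> (real^'n \<Rightarrow> real^'n \<Rightarrow> real) \<Rightarrow>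
     (real^'n \<Rightarrow> real) \<Rightarrow> (real^'n \<Rightarrow> real) \<Rightarrow> real" where
  "unweighted_form D \<gamma> u v =
     (LINT x:D|lebesgue. (LINT y:D|lebesgue. (u y - u x) * (v y - v x) * \<gamma> x y))"

text \<open>The gradient integrates over the whole space, but \<open>u\<close> and \<open>v\<close> are given on \<open>D\<close> only and
  are extended by zero. If \<open>v\<close> vanishes on the interaction domain, its extended gradient can be
  nonzero only at distance at most \<open>\<delta>\<close> from \<open>\<Omega>\<close>, and there the gradient of \<open>u\<close> only uses values
  on \<open>D\<close>, so the extension of \<open>u\<close> does not affect the weighted form.\<close>

definition zero_ext :: "(real^'n) set \<Rightarrow> (real^'n \<Rightarrow> real) \<Rightarrow> real^'n \<Rightarrow> real" where
  "zero_ext D u x = (if x \<in> D then u x else 0)"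

definition weighted_form ::
    "(real^'n) set \<Rightarrow> (real^'n \<Rightarrow> real^'n \<Rightarrow> real^'n) \<Rightarrow> (real^'n \<Rightarrow> real^'n \<Rightarrow> real) \<Rightarrow>
     (real^'n \<Rightarrow> real) \<Rightarrow> (real^'n \<Rightarrow> real) \<Rightarrow> real" where
  "weighted_form D \<alpha> \<omega> u v =
     (LINT x:D|lebesgue.
        weighted_gradient \<alpha> \<omega> (zero_ext D u) x \<bullet> weighted_gradient \<alpha> \<omega> (zero_ext D v) x)"

end

theory Submission
  imports Defs
begin

text \<open>With the singularity cut off at distance \<open>\<epsilon>\<close>, both forms are absolutely convergent integrals
  over all triples \<open>(x, y, z)\<close>: the truncation of the kernel and the vanishing of \<open>v\<close> outside
  \<open>\<Omega>\<close> confine \<open>x\<close> (respectively \<open>x\<close> and \<open>y\<close>) to the domain. Write \<open>b = \<omega> \<alpha>\<close>,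
  \<open>P\<^sub>x = b(x,y) \<bullet> b(x,z)\<close>, cyclically \<open>P\<^sub>y\<close> and \<open>P\<^sub>z\<close>, and
  \<open>Q(x,y) = (u(y) - u(x)) (v(y) - v(x))\<close>. By antisymmetry of \<open>b\<close> the kernel integrand is
  \<open>P\<^sub>x + P\<^sub>y - P\<^sub>z\<close>, and summing over the permutations of \<open>(x, y, z)\<close> both integrands
  give multiples of the same function, the cyclic sum of \<open>Q(x,y) (P\<^sub>x + P\<^sub>y - P\<^sub>z)\<close>. Since
  Lebesgue measure is permutation invariant, the cut-off forms agree, and dominated convergence
  removes the cutoff.\<close>

section \<open>Lebesgue measure on products and the reordering of coordinates\<close>

text \<open>Testing on indicators reduces an equality of measures to an identity of nonnegative
  integrals, which Tonelli can settle for maps that rearrange coordinates.\<close>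

lemma distr_lborel_eqI:
  fixes T :: "'a::euclidean_space \<Rightarrow> 'b::euclidean_space"
  assumes T: "T \<in> borel_measurable borel"
    and eq: "\<And>f::'b \<Rightarrow> ennreal. f \<in> borel_measurable borel \<Longrightarrow>
      (\<integral>\<^sup>+x. f (T x) \<partial>lborel) = (\<integral>\<^sup>+x. f x \<partial>lborel)"
  shows "distr lborel lborel T = lborel"
proof (rule measure_eqI)
  fix A assume "A \<in> sets (distr lborel lborel T)"
  then have A: "A \<in> sets borel" by simp
  have T': "T \<in> lborel \<rightarrow>\<^sub>M lborel" using T by simp
  have "emeasure (distr lborel lborel T) A = (\<integral>\<^sup>+x. indicator A x \<partial>distr lborel lborel T)"
    using A by simp
  also have "\<dots> = (\<integral>\<^sup>+x. indicator A (T x) \<partial>lborel)"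
    using A by (intro nn_integral_distr[OF T']) simp
  also have "\<dots> = (\<integral>\<^sup>+x. indicator A x \<partial>lborel)"
    using A by (intro eq) simp
  also have "\<dots> = emeasure lborel A" using A by simp
  finally show "emeasure (distr lborel lborel T) A = emeasure lborel A" .
qed simp

lemma nn_integral_lborel_pair:
  fixes f :: "'a::euclidean_space \<times> 'b::euclidean_space \<Rightarrow> ennreal"
  assumes "f \<in> borel_measurable borel"
  shows "(\<integral>\<^sup>+p. f p \<partial>lborel) = (\<integral>\<^sup>+x. \<integral>\<^sup>+y. f (x, y) \<partial>lborel \<partial>lborel)"
proof -
  have "f \<in> borel_measurable (lborel \<Otimes>\<^sub>M lborel)"
    using assms by (simp add: lborel_prod)
  from lborel.nn_integral_fst[OF this] show ?thesis
    by (simp add: lborel_prod)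
qed

lemma nn_integral_lborel_triple:
  fixes f :: "'a::euclidean_space \<times> 'b::euclidean_space \<times> 'c::euclidean_space \<Rightarrow> ennreal"
  assumes [measurable]: "f \<in> borel_measurable borel"
  shows "(\<integral>\<^sup>+p. f p \<partial>lborel) = (\<integral>\<^sup>+x. \<integral>\<^sup>+y. \<integral>\<^sup>+z. f (x, y, z) \<partial>lborel \<partial>lborel \<partial>lborel)"
proof -
  have "(\<lambda>q. f (x, q)) \<in> borel_measurable borel" for x by measurable
  then show ?thesis
    by (simp add: nn_integral_lborel_pair)
qed

lemma nn_integral_lborel_commute:
  fixes f :: "'a::euclidean_space \<Rightarrow> 'b::euclidean_space \<Rightarrow> ennreal"
  assumes "(\<lambda>(x, y). f x y) \<in> borel_measurable borel"
  shows "(\<integral>\<^sup>+x. \<integral>\<^sup>+y. f x y \<partial>lborel \<partial>lborel) = (\<integral>\<^sup>+y. \<integral>\<^sup>+x. f x y \<partial>lborel \<partial>lborel)"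
proof -
  have "case_prod f \<in> borel_measurable (lborel \<Otimes>\<^sub>M lborel)"
    using assms by (simp add: lborel_prod)
  from lborel_pair.Fubini'[OF this] show ?thesis by simp
qed

text \<open>Triples nest to the right, but in the unweighted form the pair \<open>(x, y)\<close> is
  the outer variable and \<open>z\<close> the inner one. Both sides unfold to the same iterated
  integral.\<close>

lemma distr_lborel_assoc:
  "distr lborel lborel (\<lambda>((x::'a::euclidean_space, y::'b::euclidean_space), z::'c::euclidean_space). (x, y, z)) = lborel"
proof (rule distr_lborel_eqI)
  show T: "(\<lambda>((x::'a, y::'b), z::'c). (x, y, z)) \<in> borel_measurable borel"
    unfolding split_beta by (intro borel_measurable_continuous_onI continuous_intros)
  fix f :: "'a \<times> 'b \<times> 'c \<Rightarrow> ennreal" assume f[measurable]: "f \<in> borel_measurable borel"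
  have m: "(\<lambda>t. f ((\<lambda>((x, y), z). (x, y, z)) t)) \<in> borel_measurable borel"
    by (rule measurable_compose[OF T f])
  have n: "(\<lambda>p::'a \<times> 'b. \<integral>\<^sup>+z. f (fst p, snd p, z) \<partial>lborel) \<in> borel_measurable (borel \<Otimes>\<^sub>M borel)"
    by measurable
  have "(\<integral>\<^sup>+t. f ((\<lambda>((x, y), z). (x, y, z)) t) \<partial>lborel) =
      (\<integral>\<^sup>+p. \<integral>\<^sup>+z. f (fst p, snd p, z) \<partial>lborel \<partial>lborel)"
    unfolding nn_integral_lborel_pair[OF m] by (simp add: split_beta)
  also have "\<dots> = (\<integral>\<^sup>+p. f p \<partial>lborel)"
    using n by (simp add: nn_integral_lborel_pair borel_prod nn_integral_lborel_triple[OF f])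
  finally show "(\<integral>\<^sup>+t. f ((\<lambda>((x, y), z). (x, y, z)) t) \<partial>lborel) = (\<integral>\<^sup>+p. f p \<partial>lborel)" .
qed

text \<open>Tonelli for the two inner integrals. Together with the exchange of the first two
  coordinates, this transposition generates all permutations of a triple.\<close>

lemma distr_lborel_swap_last:
  "distr lborel lborel (\<lambda>(x::'a::euclidean_space, y::'b::euclidean_space, z::'c::euclidean_space). (x, z, y)) = lborel"
proof (rule distr_lborel_eqI)
  show T: "(\<lambda>(x::'a, y::'b, z::'c). (x, z, y)) \<in> borel_measurable borel"
    unfolding split_beta by (intro borel_measurable_continuous_onI continuous_intros)
  fix f :: "'a \<times> 'c \<times> 'b \<Rightarrow> ennreal" assume f[measurable]: "f \<in> borel_measurable borel"
  have m: "(\<lambda>t. f ((\<lambda>(x, y, z). (x, z, y)) t)) \<in> borel_measurable borel"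
    by (rule measurable_compose[OF T f])
  have n: "(\<lambda>(z, y). f (x, z, y)) \<in> borel_measurable borel" for x
    unfolding split_beta prod.collapse by measurable
  show "(\<integral>\<^sup>+t. f ((\<lambda>(x, y, z). (x, z, y)) t) \<partial>lborel) = (\<integral>\<^sup>+p. f p \<partial>lborel)"
    by (simp add: nn_integral_lborel_triple[OF m] nn_integral_lborel_triple[OF f]
        nn_integral_lborel_commute[OF n, symmetric])
qed

lemma distr_lborel_swap_first:
  "distr lborel lborel (\<lambda>(x::'a::euclidean_space, y::'b::euclidean_space, z::'c::euclidean_space). (y, x, z)) = lborel"
proof (rule distr_lborel_eqI)
  show T: "(\<lambda>(x::'a, y::'b, z::'c). (y, x, z)) \<in> borel_measurable borel"
    unfolding split_beta by (intro borel_measurable_continuous_onI continuous_intros)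
  fix f :: "'b \<times> 'a \<times> 'c \<Rightarrow> ennreal" assume f[measurable]: "f \<in> borel_measurable borel"
  have m: "(\<lambda>t. f ((\<lambda>(x, y, z). (y, x, z)) t)) \<in> borel_measurable borel"
    by (rule measurable_compose[OF T f])
  have "(\<lambda>p. \<integral>\<^sup>+z. f (fst p, snd p, z) \<partial>lborel) \<in> borel_measurable (borel \<Otimes>\<^sub>M borel)"
    by measurable
  then have n: "(\<lambda>(y, x). \<integral>\<^sup>+z. f (y, x, z) \<partial>lborel) \<in> borel_measurable borel"
    by (simp add: borel_prod split_beta)
  show "(\<integral>\<^sup>+t. f ((\<lambda>(x, y, z). (y, x, z)) t) \<partial>lborel) = (\<integral>\<^sup>+p. f p \<partial>lborel)"
    by (simp add: nn_integral_lborel_triple[OF m] nn_integral_lborel_triple[OF f]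
        nn_integral_lborel_commute[OF n])
qed

lemma
  fixes f :: "'b::euclidean_space \<Rightarrow> 'c::{banach, second_countable_topology}"
    and T :: "'a::euclidean_space \<Rightarrow> 'b"
  assumes T: "T \<in> borel_measurable borel" and d: "distr lborel lborel T = lborel"
    and f: "f \<in> borel_measurable borel"
  shows integral_lborel_distr: "(LINT x|lborel. f (T x)) = (LINT x|lborel. f x)"
    and integrable_lborel_distr: "integrable lborel (\<lambda>x. f (T x)) \<longleftrightarrow> integrable lborel f"
proof -
  have T': "T \<in> lborel \<rightarrow>\<^sub>M lborel" and f': "f \<in> borel_measurable lborel" using T f by simp_all
  show "(LINT x|lborel. f (T x)) = (LINT x|lborel. f x)"
    using integral_distr[OF T' f'] by (simp add: d)
  show "integrable lborel (\<lambda>x. f (T x)) \<longleftrightarrow> integrable lborel f"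
    using integrable_distr_eq[OF T' f'] by (simp add: d)
qed

section \<open>Fubini and dominated convergence for the completed measure\<close>

text \<open>\<open>lebesgue\<close> on the product completes \<open>lborel\<close>, and completion
  does not change which properties hold almost everywhere, so the statement for
  \<open>lborel\<close> transfers.\<close>

lemma AE_lebesgue_pair:
  fixes P :: "'a::euclidean_space \<Rightarrow> 'b::euclidean_space \<Rightarrow> bool"
  assumes "AE (x, y) in lebesgue. P x y"
  shows "AE x in lebesgue. AE y in lebesgue. P x y"
proof -
  have "AE p in lborel \<Otimes>\<^sub>M lborel. case p of (x, y) \<Rightarrow> P x y"
    using assms unfolding AE_completion_iff lborel_prod .
  from lborel_pair.AE_pair[OF this] show ?thesis
    by (simp add: AE_completion_iff)
qed

text \<open>\<open>lebesgue\<close> on a product is larger than the product of the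
  \<open>lebesgue\<close> factors, so Fubini is applied to a Borel representative \<open>f'\<close>.
  Almost every section of \<open>f\<close> agrees almost everywhere with that of \<open>f'\<close>,
  and completeness makes these sections measurable.\<close>

lemma lebesgue_integral_pair:
  fixes f :: "'a::euclidean_space \<Rightarrow> 'b::euclidean_space \<Rightarrow> real"
  assumes "integrable lebesgue (\<lambda>(x, y). f x y)"
  shows "(LINT x|lebesgue. LINT y|lebesgue. f x y) = (LINT (x, y)|lebesgue. f x y)"
proof -
  obtain f' where f'[measurable]: "f' \<in> borel_measurable lborel"
    and "AE p in lborel. (\<lambda>(x, y). f x y) p = f' p"
    using completion_ex_borel_measurable_real[OF borel_measurable_integrable[OF assms]] by blast
  then have ae: "AE p in lebesgue. (\<lambda>(x, y). f x y) p = f' p"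
    by (simp add: AE_completion)
  have f'_leb: "f' \<in> borel_measurable lebesgue"
    using f' by (rule measurable_completion)
  have "integrable lebesgue f'"
    by (rule integrable_cong_AE_imp[OF assms f'_leb]) (use ae in \<open>simp add: eq_commute\<close>)
  then have int': "integrable (lborel \<Otimes>\<^sub>M lborel) f'"
    by (simp add: integrable_completion lborel_prod)
  have sec: "(\<lambda>y. f' (x, y)) \<in> borel_measurable lborel" for x
    using f' by simp
  have inner: "AE x in lebesgue. (LINT y|lebesgue. f x y) = (LINT y|lborel. f' (x, y))"
  proof -
    have "AE (x, y) in lebesgue. f x y = f' (x, y)"
      using ae by (simp add: split_beta)
    from AE_lebesgue_pair[OF this] show ?thesis
    proof eventually_elim
      case (elim x)
      have s: "(\<lambda>y. f' (x, y)) \<in> borel_measurable lebesgue"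
        using sec by (rule measurable_completion)
      have "f x \<in> borel_measurable lebesgue"
        by (rule borel_measurable_AE[OF s]) (use elim in \<open>simp add: eq_commute\<close>)
      then have "(LINT y|lebesgue. f x y) = (LINT y|lebesgue. f' (x, y))"
        using s elim by (intro integral_cong_AE) auto
      then show ?case using sec by (simp add: integral_completion)
    qed
  qed
  have outer: "(\<lambda>x. LINT y|lborel. f' (x, y)) \<in> borel_measurable lborel"
    using lborel_pair.integrable_fst'[OF int'] by simp
  have s: "(\<lambda>x. LINT y|lborel. f' (x, y)) \<in> borel_measurable lebesgue"
    using outer by (rule measurable_completion)
  have "(\<lambda>x. LINT y|lebesgue. f x y) \<in> borel_measurable lebesgue"
    by (rule borel_measurable_AE[OF s]) (use inner in \<open>simp add: eq_commute\<close>)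
  then have "(LINT x|lebesgue. LINT y|lebesgue. f x y) = (LINT x|lebesgue. LINT y|lborel. f' (x, y))"
    using s inner by (intro integral_cong_AE) auto
  also have "\<dots> = (LINT x|lborel. LINT y|lborel. f' (x, y))"
    using outer by (rule integral_completion)
  also have "\<dots> = (LINT p|lborel. f' p)"
    using lborel_pair.integral_fst'[OF int'] by (simp add: lborel_prod)
  also have "\<dots> = (LINT p|lebesgue. f' p)"
    using f' by (rule integral_completion[symmetric])
  also have "\<dots> = (LINT (x, y)|lebesgue. f x y)"
    using ae assms f'_leb by (intro integral_cong_AE) (auto simp: eq_commute dest: borel_measurable_integrable)
  finally show ?thesis .
qed

text \<open>The limit will be built from principal values, for which only almost everywhere
  convergence is known; completeness of \<open>lebesgue\<close> supplies the measurability of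
  \<open>l\<close>. The cut-off functions are Borel, so their integrals may be taken over
  \<open>lborel\<close>.\<close>

lemma
  fixes f :: "nat \<Rightarrow> 'a::euclidean_space \<Rightarrow> real"
  assumes f: "\<And>k. f k \<in> borel_measurable borel"
    and conv: "AE x in lebesgue. (\<lambda>k. f k x) \<longlonglongrightarrow> l x"
    and g: "integrable lebesgue g"
    and le: "AE x in lebesgue. \<forall>k. \<bar>f k x\<bar> \<le> g x"
  shows lebesgue_dominated_integrable: "integrable lebesgue l"
    and lebesgue_dominated_convergence:
      "(\<lambda>k. LINT x|lborel. f k x) \<longlonglongrightarrow> (LINT x|lebesgue. l x)"
proof -
  have fm: "f k \<in> borel_measurable lebesgue" for k
    using f by (intro measurable_completion) simp
  have "(\<lambda>x. lim (\<lambda>k. f k x)) \<in> borel_measurable lebesgue"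
    using fm by measurable
  then have l: "l \<in> borel_measurable lebesgue"
    by (rule borel_measurable_AE) (use conv in \<open>eventually_elim, simp add: limI\<close>)
  have le': "AE x in lebesgue. norm (f k x) \<le> g x" for k
    using le by eventually_elim simp
  show "integrable lebesgue l"
    by (rule integrable_dominated_convergence[OF l fm g conv le'])
  have "(\<lambda>k. LINT x|lebesgue. f k x) \<longlonglongrightarrow> (LINT x|lebesgue. l x)"
    by (rule integral_dominated_convergence[OF l fm g conv le'])
  then show "(\<lambda>k. LINT x|lborel. f k x) \<longlonglongrightarrow> (LINT x|lebesgue. l x)"
    using f by (simp add: integral_completion)
qed

section \<open>Principal values\<close>

lemma pv_integral_eqI:
  assumes "has_pv_integral F I"
  shows "pv_integral F = I"
  unfolding pv_integral_def
proof (rule the_equality[of "has_pv_integral F", OF assms])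
  fix J assume "has_pv_integral F J"
  then show "J = I"
    using assms unfolding has_pv_integral_def
    by (blast intro: tendsto_unique[OF trivial_limit_at_right_real])
qed

lemma has_pv_integral_pv_integral:
  "has_pv_integral F I \<Longrightarrow> has_pv_integral F (pv_integral F)"
  by (simp add: pv_integral_eqI)

text \<open>Dominated convergence is applied along sequences, so the limit is sampled at the cutoffs
  \<open>1 / (k + 1)\<close>, which approach 0 from above.\<close>

lemma has_pv_integral_sequentially:
  assumes "has_pv_integral F I"
  shows "(\<lambda>k. LINT x|lebesgue. F (inverse (real (Suc k))) x) \<longlonglongrightarrow> I"
proof -
  have "filterlim (\<lambda>k. inverse (real (Suc k))) (at_right 0) sequentially"
    using LIMSEQ_inverse_real_of_nat by (auto simp: filterlim_at)
  then show ?thesis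
    using assms by (auto simp: has_pv_integral_def intro: filterlim_compose)
qed

section \<open>Symmetrization over the permutations of a triple\<close>

text \<open>Each permutation of the variables preserves the integral, so integrating
  \<open>eq\<close> gives six copies of the integral of \<open>F\<close> and three of that of
  \<open>K\<close>.\<close>

lemma integral_symmetrization:
  fixes F K :: "'a::euclidean_space \<times> 'a \<times> 'a \<Rightarrow> real"
  assumes F: "integrable lborel F" and K: "integrable lborel K"
    and eq: "\<And>x y z. F (x, y, z) + F (x, z, y) + F (y, x, z) + F (y, z, x) + F (z, x, y) + F (z, y, x) =
      K (x, y, z) + K (y, z, x) + K (z, x, y)"
  shows "2 * (LINT t|lborel. F t) = (LINT t|lborel. K t)"
proof -
  \<comment> \<open>\<open>inv\<close> joins integrability and value, so that each transposition
    carries both along.\<close>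
  define inv where "inv f c \<longleftrightarrow> has_bochner_integral lborel f c"
    for f :: "'a \<times> 'a \<times> 'a \<Rightarrow> real" and c
  have borel: "(\<lambda>(x::'a, y::'a, z::'a). (x, z, y)) \<in> borel_measurable borel"
    "(\<lambda>(x::'a, y::'a, z::'a). (y, x, z)) \<in> borel_measurable borel"
    unfolding split_beta by (intro borel_measurable_continuous_onI continuous_intros)+
  have last: "inv (\<lambda>(x, y, z). f (x, z, y)) c" if "inv f c" for f c
  proof -
    have f: "f \<in> borel_measurable borel"
      using that unfolding inv_def by (auto dest: borel_measurable_has_bochner_integral)
    show ?thesis
      using that integral_lborel_distr[OF borel(1) distr_lborel_swap_last f]
        integrable_lborel_distr[OF borel(1) distr_lborel_swap_last f]
      by (simp add: inv_def has_bochner_integral_iff case_prod_unfold)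
  qed
  have first: "inv (\<lambda>(x, y, z). f (y, x, z)) c" if "inv f c" for f c
  proof -
    have f: "f \<in> borel_measurable borel"
      using that unfolding inv_def by (auto dest: borel_measurable_has_bochner_integral)
    show ?thesis
      using that integral_lborel_distr[OF borel(2) distr_lborel_swap_first f]
        integrable_lborel_distr[OF borel(2) distr_lborel_swap_first f]
      by (simp add: inv_def has_bochner_integral_iff case_prod_unfold)
  qed
  have perms: "inv (\<lambda>(x, y, z). f (x, y, z)) c" "inv (\<lambda>(x, y, z). f (x, z, y)) c"
    "inv (\<lambda>(x, y, z). f (y, x, z)) c" "inv (\<lambda>(x, y, z). f (y, z, x)) c"
    "inv (\<lambda>(x, y, z). f (z, x, y)) c" "inv (\<lambda>(x, y, z). f (z, y, x)) c" if f: "inv f c" for f c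
  proof -
    show "inv (\<lambda>(x, y, z). f (x, y, z)) c" using f by simp
    show yxz: "inv (\<lambda>(x, y, z). f (y, x, z)) c" by (rule first[OF f])
    show xzy: "inv (\<lambda>(x, y, z). f (x, z, y)) c" by (rule last[OF f])
    show yzx: "inv (\<lambda>(x, y, z). f (y, z, x)) c" using first[OF xzy] by simp
    show "inv (\<lambda>(x, y, z). f (z, x, y)) c" using last[OF yxz] by simp
    show "inv (\<lambda>(x, y, z). f (z, y, x)) c" using last[OF yzx] by simp
  qed
  have "inv F (LINT t|lborel. F t)" "inv K (LINT t|lborel. K t)"
    using F K by (simp_all add: inv_def has_bochner_integral_integrable)
  note pF = perms[OF this(1), unfolded inv_def] and pK = perms[OF this(2), unfolded inv_def]
  note sF = has_bochner_integral_add[OF pF(1) has_bochner_integral_add[OF pF(2)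
      has_bochner_integral_add[OF pF(3) has_bochner_integral_add[OF pF(4)
      has_bochner_integral_add[OF pF(5) pF(6)]]]]]
  \<comment> \<open>Items 1, 4 and 5 of \<open>perms\<close> are the cyclic shifts.\<close>
  note sK = has_bochner_integral_add[OF pK(1) has_bochner_integral_add[OF pK(4) pK(5)]]
  have "6 * (LINT t|lborel. F t) = 3 * (LINT t|lborel. K t)"
    using has_bochner_integral_eq[OF sF[unfolded split_beta add.assoc[symmetric] eq]
        sK[unfolded split_beta add.assoc[symmetric]]]
    by simp
  then show ?thesis by simp
qed

text \<open>Compare the coefficients of \<open>P\<^sub>x\<close>. On the left it is
  \<open>(u y - u x) * (v z - v x) + (u z - u x) * (v y - v x)\<close>, which by polarization is
  \<open>Q(x,y) + Q(x,z) - Q(y,z)\<close>; the cyclic sum on the right has the same coefficient. The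
  other two follow by symmetry.\<close>

lemma forms_symmetrized_integrands:
  fixes \<kappa> :: "real^'n \<Rightarrow> real^'n \<Rightarrow> real^'n" and u v :: "real^'n \<Rightarrow> real"
  assumes "\<And>x y. \<kappa> y x = - \<kappa> x y" and "\<And>x y. \<omega> y x = \<omega> x y"
  defines "F \<equiv> \<lambda>x y z. gradient_integrand \<kappa> \<omega> u x y \<bullet> gradient_integrand \<kappa> \<omega> v x z"
    and "K \<equiv> \<lambda>x y z. (u y - u x) * (v y - v x) * eq_kernel_integrand \<kappa> \<omega> x y z"
  shows "F x y z + F x z y + F y x z + F y z x + F z x y + F z y x = K x y z + K y z x + K z x y"
proof -
  define b where "b x y = \<omega> x y *\<^sub>R \<kappa> x y" for x y
  have grad: "gradient_integrand \<kappa> \<omega> w s t = (w t - w s) *\<^sub>R b s t" for w s t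
    by (simp add: gradient_integrand_def b_def)
  have eqk: "eq_kernel_integrand \<kappa> \<omega> x y z = b x y \<bullet> b x z + b z y \<bullet> b x y + b z y \<bullet> b x z" for x y z
    by (simp add: eq_kernel_integrand_def b_def)
  have anti: "b t s = - b s t" for s t
    unfolding b_def assms(1)[of s t] assms(2)[of s t] by simp
  have b: "b y x = - b x y" "b z x = - b x z" "b z y = - b y z"
    by (rule anti)+
  show ?thesis
    unfolding F_def K_def grad eqk b
    by (simp add: inner_commute[of "b x z" "b x y"] inner_commute[of "b y z" "b x y"]
        inner_commute[of "b y z" "b x z"] algebra_simps)
qed

section \<open>Supports of the integrands and topology of the domain\<close>

text \<open>A nonzero difference of \<open>v\<close> puts one of its two points in
  \<open>\<Omega>\<close>, and a nonzero kernel factor bounds the distance to the other point. These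
  facts let both forms be integrated over all triples without changing them.\<close>

lemma
  fixes \<kappa> :: "real^'n \<Rightarrow> real^'n \<Rightarrow> real^'n"
  assumes \<kappa>: "\<And>x y. \<kappa> x y \<noteq> 0 \<Longrightarrow> norm (x - y) \<le> \<delta>"
    and v: "\<And>x. v x \<noteq> 0 \<Longrightarrow> x \<in> \<Omega>"
    and D: "D = \<Omega> \<union> interaction_domain \<Omega> \<delta>"
  shows gradient_integrands_nonzero_imp_domain:
      "gradient_integrand \<kappa> \<omega> u x y \<bullet> gradient_integrand \<kappa> \<omega> v x z \<noteq> 0 \<Longrightarrow> x \<in> D"
    and eq_kernel_integrand_nonzero_imp_domain:
      "(u y - u x) * (v y - v x) * eq_kernel_integrand \<kappa> \<omega> x y z \<noteq> 0 \<Longrightarrow> x \<in> D \<and> y \<in> D"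
proof -
  have in_D: "t \<in> D" if "s \<in> \<Omega>" "norm (s - t) \<le> 2 * \<delta>" for s t
    using that by (auto simp: D interaction_domain_def)
  have near: "norm (s - t) \<le> 2 * \<delta>" if "\<kappa> s t \<noteq> 0" for s t
    using \<kappa>[OF that] norm_ge_zero[of "s - t"] by linarith
  show "x \<in> D" if "gradient_integrand \<kappa> \<omega> u x y \<bullet> gradient_integrand \<kappa> \<omega> v x z \<noteq> 0"
  proof -
    have *: "\<kappa> x z \<noteq> 0" "v x \<noteq> 0 \<or> v z \<noteq> 0"
      using that by (auto simp: gradient_integrand_def)
    show ?thesis
      using *(2) v in_D[of z x] near[OF *(1)] by (auto simp: D norm_minus_commute)
  qed
  show "x \<in> D \<and> y \<in> D" if K: "(u y - u x) * (v y - v x) * eq_kernel_integrand \<kappa> \<omega> x y z \<noteq> 0"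
  proof -
    have "v x \<noteq> 0 \<or> v y \<noteq> 0" using K by auto
    then have \<Omega>: "x \<in> \<Omega> \<or> y \<in> \<Omega>" using v by blast
    \<comment> \<open>The first two terms contain \<open>\<kappa> x y\<close>; the third joins
      \<open>x\<close> to \<open>y\<close> through \<open>z\<close> by two steps of length at most
      \<open>\<delta>\<close>, hence the radius \<open>2 * \<delta>\<close> of the interaction
      domain.\<close>
    have "\<kappa> x y \<noteq> 0 \<or> (\<kappa> z y \<noteq> 0 \<and> \<kappa> x z \<noteq> 0)"
      using K by (auto simp: eq_kernel_integrand_def)
    then have "norm (x - y) \<le> 2 * \<delta>"
    proof
      assume "\<kappa> z y \<noteq> 0 \<and> \<kappa> x z \<noteq> 0"
      then show ?thesis
        using \<kappa>[of z y] \<kappa>[of x z] norm_triangle_ineq[of "x - z" "z - y"] by auto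
    qed (rule near)
    with \<Omega> show ?thesis
      using in_D[of x y] in_D[of y x] by (auto simp: D norm_minus_commute)
  qed
qed

text \<open>The set is the union of the translates of \<open>\<Omega>\<close> by vectors of length
  at most \<open>2 * \<delta>\<close>. Openness makes the domain a Borel set.\<close>

lemma open_Un_interaction_domain:
  assumes "open \<Omega>" "0 \<le> \<delta>"
  shows "open (\<Omega> \<union> interaction_domain \<Omega> \<delta>)"
proof -
  have "\<Omega> \<union> interaction_domain \<Omega> \<delta> = (\<Union>c\<in>cball 0 (2 * \<delta>). (+) c ` \<Omega>)"
  proof (intro set_eqI iffI)
    fix y assume "y \<in> \<Omega> \<union> interaction_domain \<Omega> \<delta>"
    then obtain x where x: "x \<in> \<Omega>" "norm (x - y) \<le> 2 * \<delta>"
      using assms(2) by (force simp: interaction_domain_def)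
    then have "y - x \<in> cball 0 (2 * \<delta>)" "y = (y - x) + x"
      by (simp_all add: norm_minus_commute)
    then show "y \<in> (\<Union>c\<in>cball 0 (2 * \<delta>). (+) c ` \<Omega>)"
      using x(1) by blast
  next
    fix y assume "y \<in> (\<Union>c\<in>cball 0 (2 * \<delta>). (+) c ` \<Omega>)"
    then show "y \<in> \<Omega> \<union> interaction_domain \<Omega> \<delta>"
      by (auto simp: interaction_domain_def intro!: bexI)
  qed
  then show ?thesis
    using assms(1) by (auto intro: open_translation)
qed

section \<open>Measurability of the integrands\<close>

text \<open>This form can be declared as a measurability rule for curried kernels evaluated at
  arbitrary measurable arguments.\<close>

lemma borel_measurable_uncurry:
  fixes f :: "'a::second_countable_topology \<Rightarrow> 'b::second_countable_topology \<Rightarrow> 'c::topological_space"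
  assumes "(\<lambda>(x, y). f x y) \<in> borel_measurable borel"
    and "a \<in> borel_measurable M" "b \<in> borel_measurable M"
  shows "(\<lambda>t. f (a t) (b t)) \<in> borel_measurable M"
  using measurable_compose[OF borel_measurable_Pair[OF assms(2,3)] assms(1)] by simp

lemma
  fixes \<kappa> :: "real^'n \<Rightarrow> real^'n \<Rightarrow> real^'n"
  assumes \<kappa>: "(\<lambda>(x, y). \<kappa> x y) \<in> borel_measurable borel"
    and \<omega>: "(\<lambda>(x, y). \<omega> x y) \<in> borel_measurable borel"
  shows borel_measurable_gradient_integrand:
      "w \<in> borel_measurable borel \<Longrightarrow> (\<lambda>(x, y). gradient_integrand \<kappa> \<omega> w x y) \<in> borel_measurable borel"
    and borel_measurable_eq_kernel_integrand:
      "(\<lambda>(x, y, z). eq_kernel_integrand \<kappa> \<omega> x y z) \<in> borel_measurable borel"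
proof -
  note [measurable (raw)] = borel_measurable_uncurry[OF \<kappa>] borel_measurable_uncurry[OF \<omega>]
  show "(\<lambda>(x, y). gradient_integrand \<kappa> \<omega> w x y) \<in> borel_measurable borel"
    if [measurable]: "w \<in> borel_measurable borel"
    unfolding gradient_integrand_def borel_prod[symmetric] by measurable
  show "(\<lambda>(x, y, z). eq_kernel_integrand \<kappa> \<omega> x y z) \<in> borel_measurable borel"
    unfolding eq_kernel_integrand_def borel_prod[symmetric] by measurable
qed

lemma borel_measurable_cutoff_truncated_kernel:
  fixes \<rho> :: "real^'n \<Rightarrow> real^'n \<Rightarrow> real^'n"
  assumes \<rho>: "(\<lambda>(x, y). \<rho> x y) \<in> borel_measurable borel"
  shows "(\<lambda>(x, y). cutoff \<epsilon> (truncated_kernel \<rho> \<delta>) x y) \<in> borel_measurable borel"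
proof -
  note [measurable (raw)] = borel_measurable_uncurry[OF \<rho>]
  show ?thesis
    unfolding cutoff_def truncated_kernel_def borel_prod[symmetric] by measurable
qed

section \<open>Both cut-off forms as triple integrals\<close>

lemma integral_lborel_pair:
  fixes f :: "'a::euclidean_space \<times> 'b::euclidean_space \<Rightarrow> 'c::{banach, second_countable_topology}"
  assumes "integrable lborel f"
  shows "(LINT x|lborel. LINT y|lborel. f (x, y)) = (LINT p|lborel. f p)"
    and "AE x in lborel. integrable lborel (\<lambda>y. f (x, y))"
    and "integrable lborel (\<lambda>x. LINT y|lborel. f (x, y))"
  using lborel_pair.integral_fst'[of f] lborel_pair.AE_integrable_fst'[of f]
    lborel_pair.integrable_fst'[of f] assms
  by (simp_all add: lborel_prod)

text \<open>For almost every \<open>x\<close> in \<open>D\<close> the integral over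
  \<open>(y, z)\<close> factorizes by bilinearity, as both factors are integrable; off
  \<open>D\<close> both sides vanish. This turns the cut-off weighted form into a triple
  integral.\<close>

lemma integral_inner_integrals:
  fixes a :: "'a::euclidean_space \<Rightarrow> 'b::euclidean_space \<Rightarrow> 'd::euclidean_space"
    and b :: "'a \<Rightarrow> 'c::euclidean_space \<Rightarrow> 'd"
  assumes D: "D \<in> sets borel"
    and int: "integrable lborel (\<lambda>(x, y, z). a x y \<bullet> b x z)"
    and zero: "\<And>x y z. x \<notin> D \<Longrightarrow> a x y \<bullet> b x z = 0"
    and ab: "AE x in lborel. x \<in> D \<longrightarrow> integrable lborel (a x) \<and> integrable lborel (b x)"
    and meas: "(\<lambda>x. (LINT y|lborel. a x y) \<bullet> (LINT z|lborel. b x z)) \<in> borel_measurable borel"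
  shows "(LINT x|lborel. indicator D x * ((LINT y|lborel. a x y) \<bullet> (LINT z|lborel. b x z))) =
    (LINT (x, y, z)|lborel. a x y \<bullet> b x z)"
proof -
  let ?f = "\<lambda>(x, y, z). a x y \<bullet> b x z"
  have "AE x in lborel. (LINT q|lborel. ?f (x, q)) =
      indicator D x * ((LINT y|lborel. a x y) \<bullet> (LINT z|lborel. b x z))"
    using ab integral_lborel_pair(2)[OF int]
  proof eventually_elim
    case (elim x)
    show ?case
    proof (cases "x \<in> D")
      case True
      then have a: "integrable lborel (a x)" and b: "integrable lborel (b x)"
        using elim(1) by auto
      have "(LINT q|lborel. ?f (x, q)) = (LINT y|lborel. LINT z|lborel. a x y \<bullet> b x z)"
        using integral_lborel_pair(1)[OF elim(2)] by simp
      also have "\<dots> = (LINT y|lborel. a x y) \<bullet> (LINT z|lborel. b x z)"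
        using a b by simp
      finally show ?thesis using True by simp
    next
      case False
      then show ?thesis by (simp add: zero split_beta)
    qed
  qed
  then have "(LINT x|lborel. LINT q|lborel. ?f (x, q)) =
      (LINT x|lborel. indicator D x * ((LINT y|lborel. a x y) \<bullet> (LINT z|lborel. b x z)))"
    using D meas borel_measurable_integrable[OF integral_lborel_pair(3)[OF int]]
    by (intro integral_cong_AE) auto
  then show ?thesis
    using integral_lborel_pair(1)[OF int] by simp
qed

lemma
  fixes f :: "'a::euclidean_space \<Rightarrow> 'b::euclidean_space \<Rightarrow> 'c::euclidean_space \<Rightarrow> real"
  assumes int: "integrable lborel (\<lambda>(x, y, z). f x y z)"
  shows integral_lborel_triple_assoc:
      "(LINT (x, y)|lborel. LINT z|lborel. f x y z) = (LINT (x, y, z)|lborel. f x y z)"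
    and integrable_lborel_triple_assoc: "integrable lborel (\<lambda>(x, y). LINT z|lborel. f x y z)"
proof -
  let ?T = "\<lambda>((x::'a, y::'b), z::'c). (x, y, z)" and ?f = "\<lambda>(x, y, z). f x y z"
  have T: "?T \<in> borel_measurable borel"
    unfolding split_beta by (intro borel_measurable_continuous_onI continuous_intros)
  have f: "?f \<in> borel_measurable borel"
    using borel_measurable_integrable[OF int] by simp
  have "integrable lborel (\<lambda>t. ?f (?T t))"
    using integrable_lborel_distr[OF T distr_lborel_assoc f] int by blast
  note pair = integral_lborel_pair(1,3)[OF this]
  show "(LINT (x, y)|lborel. LINT z|lborel. f x y z) = (LINT (x, y, z)|lborel. f x y z)"
    using pair(1) integral_lborel_distr[OF T distr_lborel_assoc f] by (simp add: case_prod_unfold)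
  show "integrable lborel (\<lambda>(x, y). LINT z|lborel. f x y z)"
    using pair(2) by (simp add: case_prod_unfold)
qed

section \<open>Comparison of the cut-off forms and removal of the cutoff\<close>

theorem theorem5p2:
  fixes \<Omega> D :: "(real^'n) set" and \<delta> :: real
    and \<rho> \<alpha> :: "real^'n \<Rightarrow> real^'n \<Rightarrow> real^'n" and \<omega> :: "real^'n \<Rightarrow> real^'n \<Rightarrow> real"
    and u v :: "real^'n \<Rightarrow> real"
    and g :: "real^'n \<Rightarrow> real" and h :: "(real^'n) \<times> (real^'n) \<Rightarrow> real"
  assumes dim: "CARD('n) \<in> {1, 2, 3}"
    and \<Omega>: "open \<Omega>" "bounded \<Omega>"
    and \<delta>: "0 < \<delta>"
    and \<rho>_antisym: "\<And>x y. \<rho> y x = - \<rho> x y"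
    and \<omega>_nonneg: "\<And>x y. 0 \<le> \<omega> x y"
    and \<omega>_sym: "\<And>x y. \<omega> y x = \<omega> x y"
    and \<alpha>: "\<alpha> = truncated_kernel \<rho> \<delta>"
    and D: "D = \<Omega> \<union> interaction_domain \<Omega> \<delta>"
    and v_zero: "\<And>x. x \<in> interaction_domain \<Omega> \<delta> \<Longrightarrow> v x = 0"
    \<comment> \<open>measurability of the data\<close>
    and "(\<lambda>(x, y). \<rho> x y) \<in> borel_measurable borel"
    and "(\<lambda>(x, y). \<omega> x y) \<in> borel_measurable borel"
    and "set_borel_measurable borel D u" "set_borel_measurable borel D v"
    \<comment> \<open>the gradients and the equivalence kernel exist as principal values\<close>
    and "AE x in lebesgue. x \<in> D \<longrightarrow>
           (\<exists>I. has_pv_integral (\<lambda>\<epsilon>. gradient_integrand (cutoff \<epsilon> \<alpha>) \<omega> (zero_ext D u) x) I)"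
    and "AE x in lebesgue. x \<in> D \<longrightarrow>
           (\<exists>I. has_pv_integral (\<lambda>\<epsilon>. gradient_integrand (cutoff \<epsilon> \<alpha>) \<omega> (zero_ext D v) x) I)"
    and "AE (x, y) in lebesgue. x \<in> D \<longrightarrow> y \<in> D \<longrightarrow>
           (\<exists>I. has_pv_integral (\<lambda>\<epsilon>. eq_kernel_integrand (cutoff \<epsilon> \<alpha>) \<omega> x y) I)"
    \<comment> \<open>with the singularity removed, both forms converge absolutely as triple integrals\<close>
    and "\<And>\<epsilon>. 0 < \<epsilon> \<Longrightarrow> set_integrable lebesgue (D \<times> UNIV \<times> UNIV)
           (\<lambda>(x, y, z). gradient_integrand (cutoff \<epsilon> \<alpha>) \<omega> (zero_ext D u) x y \<bullet>
                         gradient_integrand (cutoff \<epsilon> \<alpha>) \<omega> (zero_ext D v) x z)"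
    and "\<And>\<epsilon>. 0 < \<epsilon> \<Longrightarrow> set_integrable lebesgue (D \<times> D \<times> UNIV)
           (\<lambda>(x, y, z). (u y - u x) * (v y - v x) * eq_kernel_integrand (cutoff \<epsilon> \<alpha>) \<omega> x y z)"
    \<comment> \<open>the integrands of both forms are bounded, uniformly in the cutoff, by integrable functions\<close>
    and "set_integrable lebesgue D g"
    and "AE x in lebesgue. x \<in> D \<longrightarrow> (\<forall>\<epsilon>>0.
           \<bar>(LINT y|lebesgue. gradient_integrand (cutoff \<epsilon> \<alpha>) \<omega> (zero_ext D u) x y) \<bullet>
            (LINT z|lebesgue. gradient_integrand (cutoff \<epsilon> \<alpha>) \<omega> (zero_ext D v) x z)\<bar> \<le> g x)"
    and "set_integrable lebesgue (D \<times> D) h"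
    and "AE (x, y) in lebesgue. x \<in> D \<longrightarrow> y \<in> D \<longrightarrow> (\<forall>\<epsilon>>0.
           \<bar>(u y - u x) * (v y - v x) *
            (LINT z|lebesgue. eq_kernel_integrand (cutoff \<epsilon> \<alpha>) \<omega> x y z)\<bar> \<le> h (x, y))"
  shows "unweighted_form D (equivalence_kernel \<alpha> \<omega>) u v = weighted_form D \<alpha> \<omega> u v"
proof -
  have D_open: "open D"
    using open_Un_interaction_domain[OF \<Omega>(1)] \<delta> by (simp add: D)
  have D_borel: "D \<in> sets borel"
    using D_open by simp
  \<comment> \<open>Permuting the variables takes points out of \<open>D\<close>, so globally
    defined functions are required. On \<open>D\<close> they agree with \<open>u\<close> and
    \<open>v\<close>, and \<open>V\<close> vanishes off \<open>\<Omega>\<close>.\<close>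
  define U where "U = zero_ext D u"
  define V where "V = zero_ext D v"
  have U_meas: "U \<in> borel_measurable borel" and V_meas: "V \<in> borel_measurable borel"
  proof -
    have "zero_ext D w = (\<lambda>x. indicator D x *\<^sub>R w x)" for w
      by (auto simp: zero_ext_def indicator_def)
    then show "U \<in> borel_measurable borel" "V \<in> borel_measurable borel"
      using assms(13,14) by (simp_all add: U_def V_def set_borel_measurable_def)
  qed
  have U_eq: "U x = u x" and V_eq: "V x = v x" if "x \<in> D" for x
    using that by (simp_all add: U_def V_def zero_ext_def)
  have V_supp: "x \<in> \<Omega>" if "V x \<noteq> 0" for x
    using that v_zero[of x] by (auto simp: V_def zero_ext_def D split: if_splits)
  define e where "e k = inverse (real (Suc k))" for k
  have e_pos: "0 < e k" for k by (simp add: e_def)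
  define A where "A k = cutoff (e k) \<alpha>" for k
  have A_anti: "A k y x = - A k x y" for k x y
    using \<rho>_antisym[of x y] by (simp add: A_def cutoff_def \<alpha> truncated_kernel_def norm_minus_commute)
  have A_supp: "norm (x - y) \<le> \<delta>" if "A k x y \<noteq> 0" for k x y
    using that by (auto simp: A_def cutoff_def \<alpha> truncated_kernel_def split: if_splits)
  have A_meas: "(\<lambda>(x, y). A k x y) \<in> borel_measurable borel" for k
    unfolding A_def \<alpha> by (rule borel_measurable_cutoff_truncated_kernel[OF assms(11)])
  define G where "G k = gradient_integrand (A k) \<omega>" for k
  define Q where "Q x y = (U y - U x) * (V y - V x)" for x y
  define K where "K k x y z = Q x y * eq_kernel_integrand (A k) \<omega> x y z" for k x y z
  have G_meas: "(\<lambda>(x, y). G k w x y) \<in> borel_measurable borel"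
    if "w \<in> borel_measurable borel" for k w
    unfolding G_def by (rule borel_measurable_gradient_integrand[OF A_meas assms(12) that])
  have eqk_meas: "(\<lambda>(x, y, z). eq_kernel_integrand (A k) \<omega> x y z) \<in> borel_measurable borel" for k
    by (rule borel_measurable_eq_kernel_integrand[OF A_meas assms(12)])
  note [measurable (raw)] = borel_measurable_uncurry[OF G_meas[OF U_meas]]
    borel_measurable_uncurry[OF G_meas[OF V_meas]]
  note [measurable] = U_meas V_meas
  have F_meas: "(\<lambda>(x, y, z). G k U x y \<bullet> G k V x z) \<in> borel_measurable borel" for k
    unfolding borel_prod[symmetric] by measurable
  have K_meas: "(\<lambda>(x, y, z). K k x y z) \<in> borel_measurable borel" for k
  proof -
    have "(\<lambda>t::(real^'n) \<times> (real^'n) \<times> (real^'n). Q (fst t) (fst (snd t))) \<in> borel_measurable (borel \<Otimes>\<^sub>M borel \<Otimes>\<^sub>M borel)"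
      unfolding Q_def by measurable
    then have "(\<lambda>t::(real^'n) \<times> (real^'n) \<times> (real^'n). Q (fst t) (fst (snd t))) \<in> borel_measurable borel"
      by (simp add: borel_prod)
    from borel_measurable_times[OF this eqk_meas[of k, unfolded case_prod_unfold]] show ?thesis
      unfolding K_def case_prod_unfold .
  qed
  have F_zero: "G k U x y \<bullet> G k V x z = 0" if "x \<notin> D" for k x y z
    using gradient_integrands_nonzero_imp_domain[of "A k" \<delta> V \<Omega> D \<omega> U x y z] A_supp V_supp D that
    by (auto simp: G_def)
  have K_zero: "K k x y z = 0" if "x \<notin> D \<or> y \<notin> D" for k x y z
    using eq_kernel_integrand_nonzero_imp_domain[of "A k" \<delta> V \<Omega> D U y x \<omega> z] A_supp V_supp D that
    by (auto simp: K_def Q_def)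
  \<comment> \<open>The integrand vanishes off \<open>D\<close>, so integrability over
    \<open>D \<times> UNIV \<times> UNIV\<close> is integrability over all triples.\<close>
  have F_int: "integrable lborel (\<lambda>(x, y, z). G k U x y \<bullet> G k V x z)" for k
  proof -
    have "(\<lambda>t. indicator (D \<times> UNIV \<times> UNIV) t *\<^sub>R (\<lambda>(x, y, z). G k U x y \<bullet> G k V x z) t) =
        (\<lambda>(x, y, z). G k U x y \<bullet> G k V x z)"
      using F_zero by (fastforce simp: indicator_def)
    then have "integrable lebesgue (\<lambda>(x, y, z). G k U x y \<bullet> G k V x z)"
      using assms(18)[OF e_pos[of k]] unfolding set_integrable_def G_def A_def U_def V_def by simp
    then show ?thesis using F_meas by (simp add: integrable_completion)
  qed
  have K_int: "integrable lborel (\<lambda>(x, y, z). K k x y z)" for k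
  proof -
    have "(\<lambda>t. indicator (D \<times> D \<times> UNIV) t *\<^sub>R
          (\<lambda>(x, y, z). (u y - u x) * (v y - v x) * eq_kernel_integrand (A k) \<omega> x y z) t) =
        (\<lambda>(x, y, z). K k x y z)"
    proof
      fix t :: "(real^'n) \<times> (real^'n) \<times> (real^'n)"
      obtain x y z where t: "t = (x, y, z)" by (cases t)
      show "indicator (D \<times> D \<times> UNIV) t *\<^sub>R
          (\<lambda>(x, y, z). (u y - u x) * (v y - v x) * eq_kernel_integrand (A k) \<omega> x y z) t =
        (\<lambda>(x, y, z). K k x y z) t"
        using K_zero[of x y k z]
        by (cases "x \<in> D \<and> y \<in> D") (auto simp: t K_def Q_def U_eq V_eq)
    qed
    then have "integrable lebesgue (\<lambda>(x, y, z). K k x y z)"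
      using assms(19)[OF e_pos[of k]] unfolding set_integrable_def A_def by simp
    then show ?thesis using K_meas by (simp add: integrable_completion)
  qed
  \<comment> \<open>The factor 2 is the one divided out in
    \<open>equivalence_kernel\<close>.\<close>
  have forms_eq: "2 * (LINT (x, y, z)|lborel. G k U x y \<bullet> G k V x z) = (LINT (x, y, z)|lborel. K k x y z)" for k
    by (rule integral_symmetrization[OF F_int K_int], unfold prod.case G_def K_def Q_def)
      (rule forms_symmetrized_integrands[OF A_anti \<omega>_sym])

  \<comment> \<open>Limit of the cut-off weighted form\<close>
  define P where "P k x = indicator D x * ((LINT y|lborel. G k U x y) \<bullet> (LINT z|lborel. G k V x z))" for k x
  have inner_meas: "(\<lambda>x. (LINT y|lborel. G k U x y) \<bullet> (LINT z|lborel. G k V x z)) \<in> borel_measurable borel" for k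
    by measurable
  have P_meas: "P k \<in> borel_measurable borel" for k
    unfolding P_def by (intro borel_measurable_times borel_measurable_indicator D_borel inner_meas)
  have sect: "G k w x \<in> borel_measurable lborel" if "w \<in> borel_measurable borel" for k w x
    by (rule borel_measurable_uncurry[OF G_meas[OF that], where a = "\<lambda>_. x" and b = "\<lambda>y. y"])
      simp_all
  \<comment> \<open>One null set serves all \<open>k\<close>, because existence of the principal
    value at \<open>x\<close> includes integrability at every positive cutoff.\<close>
  have grad_ae: "AE x in lebesgue. x \<in> D \<longrightarrow> (\<forall>k. integrable lborel (G k w x)) \<and>
      (\<lambda>k. LINT y|lborel. G k w x y) \<longlonglongrightarrow> weighted_gradient \<alpha> \<omega> w x"
    if w: "w \<in> borel_measurable borel" and
      pv: "AE x in lebesgue. x \<in> D \<longrightarrow>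
           (\<exists>I. has_pv_integral (\<lambda>\<epsilon>. gradient_integrand (cutoff \<epsilon> \<alpha>) \<omega> w x) I)" for w
    using pv
  proof eventually_elim
    case (elim x)
    show ?case
    proof
      assume "x \<in> D"
      then have pv: "has_pv_integral (\<lambda>\<epsilon>. gradient_integrand (cutoff \<epsilon> \<alpha>) \<omega> w x) (weighted_gradient \<alpha> \<omega> w x)"
        using elim has_pv_integral_pv_integral unfolding weighted_gradient_def by blast
      have "integrable lebesgue (G k w x)" for k
        using pv e_pos by (simp add: has_pv_integral_def G_def A_def)
      then have "integrable lborel (G k w x)" for k
        using sect[OF w] by (simp add: integrable_completion)
      moreover have "(\<lambda>k. LINT y|lborel. G k w x y) \<longlonglongrightarrow> weighted_gradient \<alpha> \<omega> w x"
        using has_pv_integral_sequentially[OF pv] sect[OF w]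
        by (simp add: integral_completion G_def A_def e_def)
      ultimately show "(\<forall>k. integrable lborel (G k w x)) \<and>
        (\<lambda>k. LINT y|lborel. G k w x y) \<longlonglongrightarrow> weighted_gradient \<alpha> \<omega> w x" by blast
    qed
  qed
  note ae_U = grad_ae[OF U_meas assms(15)[folded U_def]]
    and ae_V = grad_ae[OF V_meas assms(16)[folded V_def]]
  have P_int: "(LINT x|lborel. P k x) = (LINT (x, y, z)|lborel. G k U x y \<bullet> G k V x z)" for k
    unfolding P_def
  proof (rule integral_inner_integrals[OF D_borel F_int F_zero _ inner_meas])
    show "AE x in lborel. x \<in> D \<longrightarrow> integrable lborel (G k U x) \<and> integrable lborel (G k V x)"
      using ae_U[unfolded AE_completion_iff] ae_V[unfolded AE_completion_iff]
      by eventually_elim auto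
  qed
  have P_lim: "(\<lambda>k. LINT x|lborel. P k x) \<longlonglongrightarrow> weighted_form D \<alpha> \<omega> u v"
    unfolding weighted_form_def set_lebesgue_integral_def U_def[symmetric] V_def[symmetric]
  proof (rule lebesgue_dominated_convergence[OF P_meas])
    show "AE x in lebesgue. (\<lambda>k. P k x) \<longlonglongrightarrow>
        indicator D x *\<^sub>R (weighted_gradient \<alpha> \<omega> U x \<bullet> weighted_gradient \<alpha> \<omega> V x)"
      using ae_U ae_V
    proof eventually_elim
      case (elim x)
      then show ?case
        by (cases "x \<in> D") (auto simp: P_def intro: tendsto_inner)
    qed
    show "integrable lebesgue (\<lambda>x. indicator D x *\<^sub>R g x)"
      using assms(20) by (simp add: set_integrable_def)
    show "AE x in lebesgue. \<forall>k. \<bar>P k x\<bar> \<le> indicator D x *\<^sub>R g x"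
      using assms(21)
    proof eventually_elim
      case (elim x)
      have "\<bar>P k x\<bar> \<le> g x" if "x \<in> D" for k
      proof -
        have "P k x = (LINT y|lebesgue. G k U x y) \<bullet> (LINT z|lebesgue. G k V x z)"
          using that sect[OF U_meas] sect[OF V_meas] by (simp add: P_def integral_completion)
        then show ?thesis
          using elim that e_pos[of k] by (simp add: G_def A_def U_def V_def)
      qed
      then show ?case by (auto simp: P_def indicator_def)
    qed
  qed

  \<comment> \<open>Limit of the cut-off unweighted form\<close>
  define R where "R k p = (LINT z|lborel. K k (fst p) (snd p) z)" for k p
  have R_int: "(LINT p|lborel. R k p) = (LINT (x, y, z)|lborel. K k x y z)" for k
    using integral_lborel_triple_assoc[OF K_int] by (simp add: R_def case_prod_unfold)
  have R_meas: "R k \<in> borel_measurable borel" for k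
    using borel_measurable_integrable[OF integrable_lborel_triple_assoc[OF K_int]]
    by (simp add: R_def[abs_def] case_prod_unfold)
  have eqk_sect: "eq_kernel_integrand (A k) \<omega> x y \<in> borel_measurable lborel" for k x y
    using measurable_compose[OF _ eqk_meas, of "\<lambda>z. (x, y, z)" borel] by simp
  have R_eq: "R k (x, y) = (u y - u x) * (v y - v x) *
      (LINT z|lebesgue. eq_kernel_integrand (A k) \<omega> x y z)" if "x \<in> D" "y \<in> D" for k x y
    using that eqk_sect by (simp add: R_def K_def Q_def U_eq V_eq integral_completion)
  have R_zero: "R k (x, y) = 0" if "x \<notin> D \<or> y \<notin> D" for k x y
    using K_zero[OF that] by (simp add: R_def)
  \<comment> \<open>\<open>L\<close> is the integrand of the unweighted form. Since the principal
    value equals twice the equivalence kernel, \<open>R k\<close> converges to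
    \<open>2 * L\<close>.\<close>
  define L where "L x y = indicator D x * (indicator D y *
      ((u y - u x) * (v y - v x) * equivalence_kernel \<alpha> \<omega> x y))" for x y
  have R_conv: "AE p in lebesgue. (\<lambda>k. R k p) \<longlonglongrightarrow> (case p of (x, y) \<Rightarrow> 2 * L x y)"
    using assms(17)
  proof eventually_elim
    case (elim p)
    obtain x y where p: "p = (x, y)" by (cases p)
    show ?case
    proof (cases "x \<in> D \<and> y \<in> D")
      case True
      then have "has_pv_integral (\<lambda>\<epsilon>. eq_kernel_integrand (cutoff \<epsilon> \<alpha>) \<omega> x y)
          (2 * equivalence_kernel \<alpha> \<omega> x y)"
        using elim has_pv_integral_pv_integral unfolding equivalence_kernel_def p by force
      from tendsto_mult_left[OF has_pv_integral_sequentially[OF this], of "(u y - u x) * (v y - v x)"]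
      show ?thesis
        using True by (simp add: p R_eq L_def A_def e_def mult_ac)
    next
      case False
      then show ?thesis by (auto simp: p R_zero L_def)
    qed
  qed
  have h_int: "integrable lebesgue (\<lambda>p. indicator (D \<times> D) p *\<^sub>R h p)"
    using assms(22) by (simp add: set_integrable_def)
  have R_le: "AE p in lebesgue. \<forall>k. \<bar>R k p\<bar> \<le> indicator (D \<times> D) p *\<^sub>R h p"
    using assms(23)
  proof eventually_elim
    case (elim p)
    obtain x y where p: "p = (x, y)" by (cases p)
    show ?case
      using elim e_pos R_zero[of x y]
      by (cases "x \<in> D \<and> y \<in> D") (auto simp: p R_eq A_def)
  qed
  \<comment> \<open>Domination by \<open>h\<close> makes the limit integrable on pairs, which Fubini
    requires to pass to the iterated integral defining the form.\<close>
  have "integrable lebesgue (\<lambda>p. case p of (x, y) \<Rightarrow> 2 * L x y)"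
    by (rule lebesgue_dominated_integrable[OF R_meas R_conv h_int R_le])
  then have "integrable lebesgue (\<lambda>p. (1/2) * (case p of (x, y) \<Rightarrow> 2 * L x y))"
    by (rule integrable_mult_right)
  then have L_int: "integrable lebesgue (\<lambda>(x, y). L x y)"
    by (simp add: case_prod_unfold)
  have "unweighted_form D (equivalence_kernel \<alpha> \<omega>) u v = (LINT x|lebesgue. LINT y|lebesgue. L x y)"
    by (simp add: unweighted_form_def set_lebesgue_integral_def L_def)
  also have "\<dots> = (LINT (x, y)|lebesgue. L x y)"
    by (rule lebesgue_integral_pair[OF L_int])
  finally have unweighted: "(LINT p|lebesgue. (case p of (x, y) \<Rightarrow> 2 * L x y)) =
      2 * unweighted_form D (equivalence_kernel \<alpha> \<omega>) u v"
    by (simp add: case_prod_unfold)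
  \<comment> \<open>By \<open>forms_eq\<close> the same sequence also tends to twice the weighted
    form, so uniqueness of limits concludes.\<close>
  have "(\<lambda>k. LINT p|lborel. R k p) \<longlonglongrightarrow> 2 * unweighted_form D (equivalence_kernel \<alpha> \<omega>) u v"
    using lebesgue_dominated_convergence[OF R_meas R_conv h_int R_le] by (simp only: unweighted)
  moreover have "(\<lambda>k. LINT p|lborel. R k p) \<longlonglongrightarrow> 2 * weighted_form D \<alpha> \<omega> u v"
    using tendsto_mult_left[OF P_lim, of 2] by (simp add: P_int R_int forms_eq)
  ultimately show ?thesis
    using LIMSEQ_unique by force
qed

end
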